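(* Let $X$ be a locally path-connected exterior space and, for $x\in L(X)$ and $E\in\varepsilon(X)$, let $C_E(x)$ denote the path-component of $x$ in $E$. Then $X$ is $\check C_0$-complete if and only if $X$ satisfies the following conditions: (i) for every $x\in L(X)$ and every open neighbourhood $U$ of $x$ in $X$, there is $E\in\varepsilon(X)$ such that $C_E(x)\subset U$; (ii) for every $x,y\in L(X)$ with $x\neq y$, there is $E\in\varepsilon(X)$ such that $C_E(x)\cap C_E(y)=\emptyset$; (iii) if $x_\delta$ is a $\pi_0$-$\varepsilon(X)$-net, then there is $x\in L(X)$ such that $x_\delta\to x$.
   Context: Exterior spaces: an exterior space is a topological space $X$ together with a nonempty family $\varepsilon(X)$ of open subsets (an externology; its members are called exterior open subsets) closed under finite intersections and such that if $E\in\varepsilon(X)$, $U$ is open and $E\subset U$, then $U\in\varepsilon(X)$. A map between exterior spaces is exterior if it is continuous and preimages of exterior open subsets are exterior open. $\mathbf E$ is the category of exterior spaces and exterior maps. A net $x_\delta$ in $X$ is a $\pi_0$-$\varepsilon(X)$-net if for every $E\in\varepsilon(X)$ there are a path-component $C$ of $E$ and an index $\delta_0$ such that $x_\delta\in C$ for every $\delta\ge\delta_0$. Limit and end spaces: for a space $Y$, $\pi_0(Y)$ is the set of path-components with the quotient topology of $q_0\colon Y\to\pi_0(Y)$. $L(X)=\bigcap_{E\in\varepsilon(X)}E$ (subspace topology); $\check\pi_0(X)=\lim_{E\in\varepsilon(X)}\pi_0(E)$ (inverse limit topology), with projections $\eta_{0,E}\colon\check\pi_0(X)\to\pi_0(E)$;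 $e_0\colon L(X)\to\check\pi_0(X)$ sends $x$ to the family of path-components of $x$ in the sets $E$. Completion: $\check C_0(X)$ has underlying set the push-out $X\cup_{L(X)}\check\pi_0(X)$ of the inclusion $L(X)\to X$ and $e_0$, with canonical maps $p_0\colon X\to\check C_0(X)$, $\operatorname{in}_0\colon\check\pi_0(X)\to\check C_0(X)$. A subset $W$ is open iff (i) $p_0^{-1}(W)$ and $\operatorname{in}_0^{-1}(W)$ are open, and (ii) for each $a\in\operatorname{in}_0^{-1}(W)$ there are $E\in\varepsilon(X)$ and an open $G\subset\pi_0(E)$ with $a\in\eta_{0,E}^{-1}(G)\subset\operatorname{in}_0^{-1}(W)$ and $q_0^{-1}(G)\subset p_0^{-1}(W)$. Its externology is $\{W_0(E): E\in\varepsilon(X)\}$ with $W_0(E)=p_0(E)\cup\operatorname{in}_0(\check\pi_0(X))$. $X$ is $\check C_0$-complete if $p_0\colon X\to\check C_0(X)$ is an isomorphism in $\mathbf E$. *)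

theory Defs
  imports "HOL-Analysis.Analysis"
begin

section \<open>Exterior spaces\<close>

text \<open>Closure under binary intersections suffices in the definition below: the empty intersection
  \<^term>\<open>topspace X\<close> belongs to a nonempty externology by the last clause.\<close>

definition exterior_space :: "'a topology \<Rightarrow> 'a set set \<Rightarrow> bool" where
  "exterior_space X \<epsilon> \<longleftrightarrow>
     \<epsilon> \<noteq> {} \<and> (\<forall>E\<in>\<epsilon>. openin X E) \<and>
     (\<forall>E\<in>\<epsilon>. \<forall>F\<in>\<epsilon>. E \<inter> F \<in> \<epsilon>) \<and>
     (\<forall>E\<in>\<epsilon>. \<forall>U. openin X U \<and> E \<subseteq> U \<longrightarrow> U \<in> \<epsilon>)"

definition exterior_map ::
  "'a topology \<Rightarrow> 'a set set \<Rightarrow> 'b topology \<Rightarrow> 'b set set \<Rightarrow> ('a \<Rightarrow> 'b) \<Rightarrow> bool" where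
  "exterior_map X \<epsilon> Y \<epsilon>' f \<longleftrightarrow>
     continuous_map X Y f \<and> (\<forall>E\<in>\<epsilon>'. {x \<in> topspace X. f x \<in> E} \<in> \<epsilon>)"

definition exterior_iso ::
  "'a topology \<Rightarrow> 'a set set \<Rightarrow> 'b topology \<Rightarrow> 'b set set \<Rightarrow> ('a \<Rightarrow> 'b) \<Rightarrow> bool" where
  "exterior_iso X \<epsilon> Y \<epsilon>' f \<longleftrightarrow>
     exterior_map X \<epsilon> Y \<epsilon>' f \<and>
     (\<exists>g. exterior_map Y \<epsilon>' X \<epsilon> g \<and>
          (\<forall>x\<in>topspace X. g (f x) = x) \<and> (\<forall>y\<in>topspace Y. f (g y) = y))"

section \<open>Limit space and end space\<close>

text \<open>The quotient map onto \<open>pi0 Y\<close> is \<^term>\<open>path_component_of_set Y\<close>.\<close>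

definition pi0 :: "'a topology \<Rightarrow> 'a set topology" where
  "pi0 Y = topology (\<lambda>G. G \<subseteq> path_components_of Y \<and>
     openin Y {y \<in> topspace Y. path_component_of_set Y y \<in> G})"

definition limit_space :: "'a topology \<Rightarrow> 'a set set \<Rightarrow> 'a topology" where
  "limit_space X \<epsilon> = subtopology X (\<Inter>\<epsilon>)"

text \<open>The map from the path-components of a smaller set to those of \<open>E'\<close> induced by inclusion.\<close>

definition pi0_bond :: "'a topology \<Rightarrow> 'a set \<Rightarrow> 'a set \<Rightarrow> 'a set" where
  "pi0_bond X E' C = (THE D. D \<in> path_components_of (subtopology X E') \<and> C \<subseteq> D)"

text \<open>The inverse limit of the \<open>pi0 E\<close>, as a subspace of their product; a point is a function on
  \<open>\<epsilon>\<close> (extensional outside), and the projection \<open>\<eta>\<^sub>E\<close> is evaluation at \<open>E\<close>.\<close>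

definition end_space :: "'a topology \<Rightarrow> 'a set set \<Rightarrow> ('a set \<Rightarrow> 'a set) topology" where
  "end_space X \<epsilon> = subtopology (product_topology (\<lambda>E. pi0 (subtopology X E)) \<epsilon>)
     {a. \<forall>E\<in>\<epsilon>. \<forall>E'\<in>\<epsilon>. E \<subseteq> E' \<longrightarrow> pi0_bond X E' (a E) = a E'}"

definition e0 :: "'a topology \<Rightarrow> 'a set set \<Rightarrow> 'a \<Rightarrow> ('a set \<Rightarrow> 'a set)" where
  "e0 X \<epsilon> x = (\<lambda>E\<in>\<epsilon>. path_component_of_set (subtopology X E) x)"

section \<open>The completion\<close>

text \<open>The equivalence relation generated by identifying each \<open>x\<close> in the limit space with
  \<open>e0 x\<close>; the push-out is the quotient of the disjoint union by it.\<close>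

definition glue_rel ::
  "'a topology \<Rightarrow> 'a set set \<Rightarrow> (('a + ('a set \<Rightarrow> 'a set)) \<times> ('a + ('a set \<Rightarrow> 'a set))) set" where
  "glue_rel X \<epsilon> =
     (let R = {(Inl x, Inr (e0 X \<epsilon> x)) | x. x \<in> topspace (limit_space X \<epsilon>)} in (R \<union> R\<inverse>)\<^sup>*)"

definition C0_set :: "'a topology \<Rightarrow> 'a set set \<Rightarrow> ('a + ('a set \<Rightarrow> 'a set)) set set" where
  "C0_set X \<epsilon> = (topspace X <+> topspace (end_space X \<epsilon>)) // glue_rel X \<epsilon>"

definition p0 :: "'a topology \<Rightarrow> 'a set set \<Rightarrow> 'a \<Rightarrow> ('a + ('a set \<Rightarrow> 'a set)) set" where
  "p0 X \<epsilon> x = glue_rel X \<epsilon> `` {Inl x}"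

definition in0 ::
  "'a topology \<Rightarrow> 'a set set \<Rightarrow> ('a set \<Rightarrow> 'a set) \<Rightarrow> ('a + ('a set \<Rightarrow> 'a set)) set" where
  "in0 X \<epsilon> a = glue_rel X \<epsilon> `` {Inr a}"

definition C0_open ::
  "'a topology \<Rightarrow> 'a set set \<Rightarrow> ('a + ('a set \<Rightarrow> 'a set)) set set \<Rightarrow> bool" where
  "C0_open X \<epsilon> W \<longleftrightarrow>
     W \<subseteq> C0_set X \<epsilon> \<and>
     (let P = {x \<in> topspace X. p0 X \<epsilon> x \<in> W};
          I = {a \<in> topspace (end_space X \<epsilon>). in0 X \<epsilon> a \<in> W}
      in openin X P \<and> openin (end_space X \<epsilon>) I \<and>
         (\<forall>a\<in>I. \<exists>E\<in>\<epsilon>. \<exists>G. openin (pi0 (subtopology X E)) G \<and>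
            a \<in> {b \<in> topspace (end_space X \<epsilon>). b E \<in> G} \<and>
            {b \<in> topspace (end_space X \<epsilon>). b E \<in> G} \<subseteq> I \<and>
            {x \<in> topspace (subtopology X E). path_component_of_set (subtopology X E) x \<in> G} \<subseteq> P))"

definition C0 :: "'a topology \<Rightarrow> 'a set set \<Rightarrow> ('a + ('a set \<Rightarrow> 'a set)) set topology" where
  "C0 X \<epsilon> = topology (C0_open X \<epsilon>)"

definition C0_ext :: "'a topology \<Rightarrow> 'a set set \<Rightarrow> ('a + ('a set \<Rightarrow> 'a set)) set set set" where
  "C0_ext X \<epsilon> = {p0 X \<epsilon> ` E \<union> in0 X \<epsilon> ` topspace (end_space X \<epsilon>) | E. E \<in> \<epsilon>}"

definition C0_complete :: "'a topology \<Rightarrow> 'a set set \<Rightarrow> bool" where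
  "C0_complete X \<epsilon> \<longleftrightarrow> exterior_iso X \<epsilon> (C0 X \<epsilon>) (C0_ext X \<epsilon>) (p0 X \<epsilon>)"

section \<open>Nets\<close>

text \<open>A net is a function on a directed set (a directed preorder), given by a carrier \<open>D\<close> and a
  relation \<open>le\<close> on it. HOL cannot quantify over all index types inside a formula. For a statement
  about all nets in a space of type \<open>'a topology\<close>, let \<open>D\<close> range over the subsets of
  \<open>'i + 'a set\<close> with \<open>'i\<close> a free type variable: this covers every directed set of any type
  \<open>'i\<close>, and always leaves room for nets indexed by families of subsets of the space.\<close>

definition directed_set :: "'i set \<Rightarrow> ('i \<Rightarrow> 'i \<Rightarrow> bool) \<Rightarrow> bool" where
  "directed_set D le \<longleftrightarrow>
     D \<noteq> {} \<and> (\<forall>d\<in>D. le d d) \<and>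
     (\<forall>a\<in>D. \<forall>b\<in>D. \<forall>c\<in>D. le a b \<and> le b c \<longrightarrow> le a c) \<and>
     (\<forall>a\<in>D. \<forall>b\<in>D. \<exists>c\<in>D. le a c \<and> le b c)"

definition pi0_net ::
  "'a topology \<Rightarrow> 'a set set \<Rightarrow> 'i set \<Rightarrow> ('i \<Rightarrow> 'i \<Rightarrow> bool) \<Rightarrow> ('i \<Rightarrow> 'a) \<Rightarrow> bool" where
  "pi0_net X \<epsilon> D le x \<longleftrightarrow>
     directed_set D le \<and> (\<forall>d\<in>D. x d \<in> topspace X) \<and>
     (\<forall>E\<in>\<epsilon>. \<exists>C\<in>path_components_of (subtopology X E). \<exists>d0\<in>D. \<forall>d\<in>D. le d0 d \<longrightarrow> x d \<in> C)"

text \<open>Convergence of nets is \<^const>\<open>limitin\<close> along the filter of tails.\<close>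

definition tails :: "'i set \<Rightarrow> ('i \<Rightarrow> 'i \<Rightarrow> bool) \<Rightarrow> 'i filter" where
  "tails D le = (INF d0\<in>D. principal {d\<in>D. le d0 d})"

lemma eventually_tails:
  assumes "directed_set D le"
  shows "eventually P (tails D le) \<longleftrightarrow> (\<exists>d0\<in>D. \<forall>d\<in>D. le d0 d \<longrightarrow> P d)"
proof -
  have "eventually P (tails D le) \<longleftrightarrow> (\<exists>d0\<in>D. eventually P (principal {d\<in>D. le d0 d}))"
    unfolding tails_def
  proof (rule eventually_INF_base)
    show "D \<noteq> {}" using assms by (simp add: directed_set_def)
    fix a b assume ab: "a \<in> D" "b \<in> D"
    have trans: "\<And>a b c. a \<in> D \<Longrightarrow> b \<in> D \<Longrightarrow> c \<in> D \<Longrightarrow> le a b \<Longrightarrow> le b c \<Longrightarrow> le a c"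
      using assms unfolding directed_set_def by meson
    obtain c where c: "c \<in> D" "le a c" "le b c"
      using assms ab unfolding directed_set_def by meson
    have "{d \<in> D. le c d} \<subseteq> {d \<in> D. le a d} \<inter> {d \<in> D. le b d}"
      using trans ab c by blast
    then have "principal {d \<in> D. le c d} \<le>
        inf (principal {d \<in> D. le a d}) (principal {d \<in> D. le b d})"
      unfolding inf_principal principal_le_iff .
    then show "\<exists>x\<in>D. principal {d \<in> D. le x d} \<le>
        inf (principal {d \<in> D. le a d}) (principal {d \<in> D. le b d})"
      using c(1) by (rule bexI)
  qed
  also have "\<dots> \<longleftrightarrow> (\<exists>d0\<in>D. \<forall>d\<in>D. le d0 d \<longrightarrow> P d)"
    unfolding eventually_principal by blast
  finally show ?thesis .
qed

section \<open>The topologies and the externology above are well defined\<close>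

lemma openin_pi0:
  "openin (pi0 Y) G \<longleftrightarrow> G \<subseteq> path_components_of Y \<and>
     openin Y {y \<in> topspace Y. path_component_of_set Y y \<in> G}"
proof -
  let ?q = "path_component_of_set Y"
  have "istopology (\<lambda>G. G \<subseteq> path_components_of Y \<and> openin Y {y \<in> topspace Y. ?q y \<in> G})"
    unfolding istopology_def
  proof (intro conjI allI impI)
    fix S T
    assume S: "S \<subseteq> path_components_of Y \<and> openin Y {y \<in> topspace Y. ?q y \<in> S}"
      and T: "T \<subseteq> path_components_of Y \<and> openin Y {y \<in> topspace Y. ?q y \<in> T}"
    have eq: "{y \<in> topspace Y. ?q y \<in> S \<inter> T} =
        {y \<in> topspace Y. ?q y \<in> S} \<inter> {y \<in> topspace Y. ?q y \<in> T}" by blast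
    show "S \<inter> T \<subseteq> path_components_of Y" using S by blast
    show "openin Y {y \<in> topspace Y. ?q y \<in> S \<inter> T}" unfolding eq using S T by blast
  next
    fix \<K>
    assume K: "\<forall>S\<in>\<K>. S \<subseteq> path_components_of Y \<and> openin Y {y \<in> topspace Y. ?q y \<in> S}"
    have eq: "{y \<in> topspace Y. ?q y \<in> \<Union>\<K>} = (\<Union>S\<in>\<K>. {y \<in> topspace Y. ?q y \<in> S})" by blast
    show "\<Union>\<K> \<subseteq> path_components_of Y" using K by blast
    show "openin Y {y \<in> topspace Y. ?q y \<in> \<Union>\<K>}" unfolding eq using K by blast
  qed
  then show ?thesis unfolding pi0_def by (simp add: topology_inverse')
qed

lemma topspace_pi0 [simp]: "topspace (pi0 Y) = path_components_of Y"
proof -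
  have "openin (pi0 Y) (path_components_of Y)"
    by (simp add: openin_pi0 path_component_in_path_components_of)
  then show ?thesis
    by (metis openin_pi0 openin_subset openin_topspace subset_antisym)
qed

lemma pi0_bond_eq:
  assumes "E \<subseteq> E'" "C \<in> path_components_of (subtopology X E)" "x \<in> C"
  shows "pi0_bond X E' C = path_component_of_set (subtopology X E') x"
proof -
  have pc: "path_connectedin (subtopology X E') C"
    using path_connectedin_path_components_of[OF assms(2)] assms(1)
    by (auto simp: path_connectedin_subtopology)
  have sub: "C \<subseteq> path_component_of_set (subtopology X E') x"
    using pc assms(3) by (rule path_component_of_maximal)
  have x: "x \<in> topspace (subtopology X E')"
    using pc assms(3) path_connectedin_subset_topspace by blast
  show ?thesis unfolding pi0_bond_def
  proof (rule the_equality)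
    show "path_component_of_set (subtopology X E') x \<in> path_components_of (subtopology X E')
        \<and> C \<subseteq> path_component_of_set (subtopology X E') x"
      using x sub by (simp add: path_components_of_def)
    fix D assume D: "D \<in> path_components_of (subtopology X E') \<and> C \<subseteq> D"
    then obtain z where z: "D = path_component_of_set (subtopology X E') z"
      by (auto simp: path_components_of_def)
    then have "path_component_of (subtopology X E') z x" using D assms(3) by blast
    then show "D = path_component_of_set (subtopology X E') x"
      unfolding z by (simp only: path_component_of_equiv)
  qed
qed

context
  fixes X :: "'a topology" and \<epsilon> :: "'a set set"
  assumes ext: "exterior_space X \<epsilon>"
begin

lemma ext_nonempty: "\<epsilon> \<noteq> {}"
  and ext_open: "E \<in> \<epsilon> \<Longrightarrow> openin X E"
  and ext_Int: "E \<in> \<epsilon> \<Longrightarrow> F \<in> \<epsilon> \<Longrightarrow> E \<inter> F \<in> \<epsilon>"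
  and ext_up: "E \<in> \<epsilon> \<Longrightarrow> openin X U \<Longrightarrow> E \<subseteq> U \<Longrightarrow> U \<in> \<epsilon>"
  using ext unfolding exterior_space_def by meson+

lemma ext_subset: "E \<in> \<epsilon> \<Longrightarrow> E \<subseteq> topspace X"
  using ext_open openin_subset by metis

lemma end_space_mem:
  assumes "a \<in> topspace (end_space X \<epsilon>)" "E \<in> \<epsilon>"
  shows "a E \<in> path_components_of (subtopology X E)"
  using assms by (auto simp: end_space_def PiE_iff)

lemma end_space_mono:
  assumes "a \<in> topspace (end_space X \<epsilon>)" "E \<in> \<epsilon>" "E' \<in> \<epsilon>" "E \<subseteq> E'" "x \<in> a E"
  shows "a E' = path_component_of_set (subtopology X E') x"
proof -
  have "pi0_bond X E' (a E) = a E'" using assms by (auto simp: end_space_def)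
  then show ?thesis using pi0_bond_eq[OF assms(4) end_space_mem[OF assms(1,2)] assms(5)] by simp
qed

lemma e0_in_end_space:
  assumes "x \<in> \<Inter>\<epsilon>"
  shows "e0 X \<epsilon> x \<in> topspace (end_space X \<epsilon>)"
proof -
  have top: "x \<in> topspace (subtopology X E)" if "E \<in> \<epsilon>" for E
    using ext_subset[OF that] that assms by auto
  have "pi0_bond X E' (path_component_of_set (subtopology X E) x)
      = path_component_of_set (subtopology X E') x" if "E \<in> \<epsilon>" "E' \<in> \<epsilon>" "E \<subseteq> E'" for E E'
    using that top[of E]
    by (intro pi0_bond_eq[of E]) (simp_all add: path_components_of_def path_component_of_refl)
  then show ?thesis using top
    by (auto simp: end_space_def e0_def PiE_iff path_components_of_def)
qed

lemma topspace_limit_space: "topspace (limit_space X \<epsilon>) = \<Inter>\<epsilon>"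
proof -
  have "\<Inter>\<epsilon> \<subseteq> topspace X" using ext_nonempty ext_subset by blast
  then show ?thesis by (simp add: limit_space_def Int_absorb1)
qed

lemma istopology_C0_open: "istopology (C0_open X \<epsilon>)"
  unfolding istopology_def
proof (intro conjI allI impI)
  fix S T assume S: "C0_open X \<epsilon> S" and T: "C0_open X \<epsilon> T"
  let ?q = "\<lambda>E. path_component_of_set (subtopology X E)"
  let ?P = "\<lambda>W. {x \<in> topspace X. p0 X \<epsilon> x \<in> W}"
  let ?I = "\<lambda>W. {a \<in> topspace (end_space X \<epsilon>). in0 X \<epsilon> a \<in> W}"
  have P: "?P (S \<inter> T) = ?P S \<inter> ?P T" and I: "?I (S \<inter> T) = ?I S \<inter> ?I T" by blast+
  have "\<exists>E\<in>\<epsilon>. \<exists>G. openin (pi0 (subtopology X E)) G \<and>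
            a \<in> {b \<in> topspace (end_space X \<epsilon>). b E \<in> G} \<and>
            {b \<in> topspace (end_space X \<epsilon>). b E \<in> G} \<subseteq> ?I S \<inter> ?I T \<and>
            {x \<in> topspace (subtopology X E). ?q E x \<in> G} \<subseteq> ?P S \<inter> ?P T"
    if a: "a \<in> ?I S \<inter> ?I T" for a
  proof -
    obtain E1 G1 where 1: "E1 \<in> \<epsilon>" "openin (pi0 (subtopology X E1)) G1" "a E1 \<in> G1"
      "{b \<in> topspace (end_space X \<epsilon>). b E1 \<in> G1} \<subseteq> ?I S"
      "{x \<in> topspace (subtopology X E1). ?q E1 x \<in> G1} \<subseteq> ?P S"
      using S a unfolding C0_open_def Let_def by blast
    obtain E2 G2 where 2: "E2 \<in> \<epsilon>" "openin (pi0 (subtopology X E2)) G2" "a E2 \<in> G2"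
      "{b \<in> topspace (end_space X \<epsilon>). b E2 \<in> G2} \<subseteq> ?I T"
      "{x \<in> topspace (subtopology X E2). ?q E2 x \<in> G2} \<subseteq> ?P T"
      using T a unfolding C0_open_def Let_def by blast
    define E where "E = E1 \<inter> E2"
    have E: "E \<in> \<epsilon>" "E \<subseteq> E1" "E \<subseteq> E2" "openin X E1" "openin X E2" "openin X E"
      using ext_open[OF 1(1)] ext_open[OF 2(1)] ext_Int[OF 1(1) 2(1)] unfolding E_def by auto
    define H where "H = {x \<in> topspace (subtopology X E). ?q E1 x \<in> G1 \<and> ?q E2 x \<in> G2}"
    define G where "G = ?q E ` H"
    have same: "?q E1 x = ?q E1 y \<and> ?q E2 x = ?q E2 y" if "?q E x = ?q E y" "x \<in> topspace (subtopology X E)" for x y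
    proof -
      have "y \<in> ?q E y"
        using path_component_of_eq_empty[of "subtopology X E" x] path_component_of_eq_empty[of "subtopology X E" y]
          that by (simp add: path_component_of_refl)
      moreover have "?q E y \<in> path_components_of (subtopology X E)"
        unfolding that(1)[symmetric] using that(2) by (simp add: path_components_of_def)
      moreover have "x \<in> ?q E y"
        unfolding that(1)[symmetric] using that(2) by (simp add: path_component_of_refl)
      ultimately show ?thesis
        using pi0_bond_eq[OF E(2)] pi0_bond_eq[OF E(3)] by metis
    qed
    have pre: "{x \<in> topspace (subtopology X E). ?q E x \<in> G} = H"
    proof (intro set_eqI iffI)
      fix x assume x: "x \<in> {x \<in> topspace (subtopology X E). ?q E x \<in> G}"
      then obtain h where h: "h \<in> H" "?q E x = ?q E h" unfolding G_def by blast
      then show "x \<in> H" using same[of x h] x unfolding H_def by simp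
    next
      fix x assume "x \<in> H"
      then show "x \<in> {x \<in> topspace (subtopology X E). ?q E x \<in> G}"
        unfolding G_def H_def by blast
    qed
    have opH: "openin X H"
    proof -
      have "H = E \<inter> ({x \<in> topspace (subtopology X E1). ?q E1 x \<in> G1} \<inter>
                     {x \<in> topspace (subtopology X E2). ?q E2 x \<in> G2})"
        using openin_subset[OF E(6)] unfolding H_def E_def by auto
      moreover have "openin X {x \<in> topspace (subtopology X E1). ?q E1 x \<in> G1}"
        using 1(2) E(4) unfolding openin_pi0 by (meson openin_trans_full)
      moreover have "openin X {x \<in> topspace (subtopology X E2). ?q E2 x \<in> G2}"
        using 2(2) E(5) unfolding openin_pi0 by (meson openin_trans_full)
      ultimately show ?thesis using E(6) by auto
    qed
    have opG: "openin (pi0 (subtopology X E)) G"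
      unfolding openin_pi0 pre
    proof
      show "G \<subseteq> path_components_of (subtopology X E)"
        unfolding G_def H_def path_components_of_def by blast
      have "H \<subseteq> E" unfolding H_def by auto
      then show "openin (subtopology X E) H"
        using opH E(6) by (simp add: openin_open_subtopology)
    qed
    have evG: "b E \<in> G \<longleftrightarrow> b E1 \<in> G1 \<and> b E2 \<in> G2" if b: "b \<in> topspace (end_space X \<epsilon>)" for b
    proof -
      obtain z where z: "z \<in> topspace (subtopology X E)" "b E = ?q E z"
        using end_space_mem[OF b E(1)] unfolding path_components_of_def by blast
      then have zb: "z \<in> b E" by (simp add: path_component_of_refl)
      have "b E1 = ?q E1 z" "b E2 = ?q E2 z"
        using end_space_mono[OF b E(1) 1(1) E(2) zb] end_space_mono[OF b E(1) 2(1) E(3) zb] .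
      moreover have "b E \<in> G \<longleftrightarrow> z \<in> H" unfolding pre[symmetric] using z by simp
      ultimately show ?thesis using z(1) unfolding H_def by simp
    qed
    have H1: "H \<subseteq> {x \<in> topspace (subtopology X E1). ?q E1 x \<in> G1}"
      and H2: "H \<subseteq> {x \<in> topspace (subtopology X E2). ?q E2 x \<in> G2}"
      unfolding H_def E_def by auto
    show ?thesis
    proof (intro bexI exI conjI)
      show "openin (pi0 (subtopology X E)) G" by (fact opG)
      show "a \<in> {b \<in> topspace (end_space X \<epsilon>). b E \<in> G}" using a evG 1(3) 2(3) by blast
      show "{b \<in> topspace (end_space X \<epsilon>). b E \<in> G} \<subseteq> ?I S \<inter> ?I T" using evG 1(4) 2(4) by blast
      show "{x \<in> topspace (subtopology X E). ?q E x \<in> G} \<subseteq> ?P S \<inter> ?P T"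
        unfolding pre using H1 H2 1(5) 2(5) by blast
      show "E \<in> \<epsilon>" by (fact E(1))
    qed
  qed
  moreover have "S \<inter> T \<subseteq> C0_set X \<epsilon>" "openin X (?P S \<inter> ?P T)"
      "openin (end_space X \<epsilon>) (?I S \<inter> ?I T)"
    using S T by (simp_all add: C0_open_def Let_def openin_Int le_infI1)
  ultimately show "C0_open X \<epsilon> (S \<inter> T)"
    unfolding C0_open_def Let_def P I by (intro conjI ballI)
next
  fix \<K> assume K: "\<forall>W\<in>\<K>. C0_open X \<epsilon> W"
  let ?P = "\<lambda>W. {x \<in> topspace X. p0 X \<epsilon> x \<in> W}"
  let ?I = "\<lambda>W. {a \<in> topspace (end_space X \<epsilon>). in0 X \<epsilon> a \<in> W}"
  have P: "?P (\<Union>\<K>) = \<Union>(?P ` \<K>)" and I: "?I (\<Union>\<K>) = \<Union>(?I ` \<K>)" by blast+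
  show "C0_open X \<epsilon> (\<Union>\<K>)"
    unfolding C0_open_def Let_def
  proof (intro conjI ballI)
    show "\<Union>\<K> \<subseteq> C0_set X \<epsilon>" using K unfolding C0_open_def by blast
    show "openin X (?P (\<Union>\<K>))" unfolding P using K unfolding C0_open_def Let_def by blast
    show "openin (end_space X \<epsilon>) (?I (\<Union>\<K>))" unfolding I using K unfolding C0_open_def Let_def by blast
    fix a assume "a \<in> ?I (\<Union>\<K>)"
    then obtain W where W: "W \<in> \<K>" "a \<in> ?I W" by blast
    have CW: "C0_open X \<epsilon> W" using K W(1) by (rule bspec)
    obtain E G where EG: "E \<in> \<epsilon>" "openin (pi0 (subtopology X E)) G"
      "a \<in> {b \<in> topspace (end_space X \<epsilon>). b E \<in> G}"
      "{b \<in> topspace (end_space X \<epsilon>). b E \<in> G} \<subseteq> ?I W"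
      "{x \<in> topspace (subtopology X E). path_component_of_set (subtopology X E) x \<in> G} \<subseteq> ?P W"
      using CW W(2) unfolding C0_open_def Let_def by blast
    have "?I W \<subseteq> ?I (\<Union>\<K>)" "?P W \<subseteq> ?P (\<Union>\<K>)" using W(1) by blast+
    then show "\<exists>E\<in>\<epsilon>. \<exists>G. openin (pi0 (subtopology X E)) G \<and>
            a \<in> {b \<in> topspace (end_space X \<epsilon>). b E \<in> G} \<and>
            {b \<in> topspace (end_space X \<epsilon>). b E \<in> G} \<subseteq> ?I (\<Union>\<K>) \<and>
            {x \<in> topspace (subtopology X E). path_component_of_set (subtopology X E) x \<in> G} \<subseteq> ?P (\<Union>\<K>)"
      using EG by (meson order_trans)
  qed
qed

lemma openin_C0: "openin (C0 X \<epsilon>) W \<longleftrightarrow> C0_open X \<epsilon> W"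
  unfolding C0_def by (simp add: topology_inverse' istopology_C0_open)

lemma glue_rel_outside:
  assumes "x \<notin> \<Inter>\<epsilon>"
  shows "p0 X \<epsilon> x = {Inl x}"
proof -
  have "z = Inl x" if "(Inl x, z) \<in> glue_rel X \<epsilon>" for z
    using that unfolding glue_rel_def Let_def topspace_limit_space
    by (rule converse_rtranclE) (use assms in auto)
  moreover have "(Inl x, Inl x) \<in> glue_rel X \<epsilon>" by (simp add: glue_rel_def Let_def)
  ultimately show ?thesis unfolding p0_def by blast
qed

lemma in_p0: "Inl x \<in> p0 X \<epsilon> x" and in_in0: "Inr a \<in> in0 X \<epsilon> a"
  unfolding p0_def in0_def glue_rel_def Let_def by (rule ImageI[OF rtrancl_refl singletonI])+

lemma p0_preimage_W0:
  assumes "E \<in> \<epsilon>"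
  shows "{x \<in> topspace X. p0 X \<epsilon> x \<in> p0 X \<epsilon> ` E \<union> in0 X \<epsilon> ` topspace (end_space X \<epsilon>)} = E"
proof -
  have "E \<subseteq> topspace X" using assms by (rule ext_subset)
  moreover have "x \<in> E" if x: "p0 X \<epsilon> x \<in> p0 X \<epsilon> ` E \<union> in0 X \<epsilon> ` topspace (end_space X \<epsilon>)" for x
  proof (cases "x \<in> \<Inter>\<epsilon>")
    case False
    note out = glue_rel_outside[OF this]
    from x consider y where "y \<in> E" "p0 X \<epsilon> x = p0 X \<epsilon> y" | a where "p0 X \<epsilon> x = in0 X \<epsilon> a"
      by blast
    then show ?thesis
    proof cases
      case 1
      then have "Inl y \<in> {Inl x :: 'a + ('a set \<Rightarrow> 'a set)}" using in_p0[of y] out by simp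
      then show ?thesis using 1 by simp
    next
      case 2
      then have "Inr a \<in> {Inl x :: 'a + ('a set \<Rightarrow> 'a set)}" using in_in0[of a] out by simp
      then show ?thesis by simp
    qed
  qed (use assms in blast)
  ultimately show ?thesis by blast
qed

lemma exterior_space_C0: "exterior_space (C0 X \<epsilon>) (C0_ext X \<epsilon>)"
proof -
  let ?J = "in0 X \<epsilon> ` topspace (end_space X \<epsilon>)"
  let ?W = "\<lambda>E. p0 X \<epsilon> ` E \<union> ?J"
  have sub: "E \<subseteq> topspace X" "openin X E" if "E \<in> \<epsilon>" for E
    using that by (simp_all add: ext_open ext_subset)
  have op: "openin (C0 X \<epsilon>) (?W E)" if E: "E \<in> \<epsilon>" for E
    unfolding openin_C0 C0_open_def Let_def p0_preimage_W0[OF E]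
  proof (intro conjI ballI)
    show "?W E \<subseteq> C0_set X \<epsilon>"
      using sub(1)[OF E] unfolding C0_set_def p0_def in0_def by (auto intro!: quotientI)
    show "openin X E" using sub(2)[OF E] .
    have I: "{a \<in> topspace (end_space X \<epsilon>). in0 X \<epsilon> a \<in> ?W E} = topspace (end_space X \<epsilon>)" by blast
    show "openin (end_space X \<epsilon>) {a \<in> topspace (end_space X \<epsilon>). in0 X \<epsilon> a \<in> ?W E}"
      unfolding I by simp
    fix a assume "a \<in> {a \<in> topspace (end_space X \<epsilon>). in0 X \<epsilon> a \<in> ?W E}"
    then have a: "a \<in> topspace (end_space X \<epsilon>)" by blast
    show "\<exists>F\<in>\<epsilon>. \<exists>G. openin (pi0 (subtopology X F)) G \<and>
            a \<in> {b \<in> topspace (end_space X \<epsilon>). b F \<in> G} \<and>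
            {b \<in> topspace (end_space X \<epsilon>). b F \<in> G}
              \<subseteq> {a \<in> topspace (end_space X \<epsilon>). in0 X \<epsilon> a \<in> ?W E} \<and>
            {x \<in> topspace (subtopology X F). path_component_of_set (subtopology X F) x \<in> G} \<subseteq> E"
      unfolding I
    proof (intro bexI exI conjI)
      show "openin (pi0 (subtopology X E)) (path_components_of (subtopology X E))"
        using openin_topspace[of "pi0 (subtopology X E)"] by simp
    qed (use E a end_space_mem[OF a E] in auto)
  qed
  have int: "?W E \<inter> ?W F = ?W (E \<inter> F)" if "E \<in> \<epsilon>" "F \<in> \<epsilon>" for E F
  proof -
    have "w \<in> ?W (E \<inter> F)" if w: "w \<in> ?W E" "w \<in> ?W F" for w
    proof (cases "w \<in> ?J")
      case False
      then obtain x where x: "x \<in> E" "w = p0 X \<epsilon> x" using w(1) by blast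
      then have "x \<in> F" using p0_preimage_W0[OF \<open>F \<in> \<epsilon>\<close>] w(2) sub(1)[OF \<open>E \<in> \<epsilon>\<close>] by blast
      then show ?thesis using x by blast
    qed blast
    then show ?thesis by blast
  qed
  have up: "W \<in> C0_ext X \<epsilon>" if E: "E \<in> \<epsilon>" and W: "openin (C0 X \<epsilon>) W" "?W E \<subseteq> W" for E W
  proof -
    let ?E = "{x \<in> topspace X. p0 X \<epsilon> x \<in> W}"
    have WC: "W \<subseteq> C0_set X \<epsilon>" "openin X ?E"
      using W(1) unfolding openin_C0 C0_open_def Let_def by blast+
    have "E \<subseteq> ?E" using sub(1)[OF E] W(2) by blast
    then have "?E \<in> \<epsilon>" using ext_up[OF E WC(2)] by simp
    moreover have "W = ?W ?E"
    proof
      show "W \<subseteq> ?W ?E"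
      proof
        fix w assume w: "w \<in> W"
        then obtain z where "z \<in> topspace X <+> topspace (end_space X \<epsilon>)" "w = glue_rel X \<epsilon> `` {z}"
          using WC(1) unfolding C0_set_def by (auto elim!: quotientE)
        then show "w \<in> ?W ?E" using w unfolding p0_def in0_def by auto
      qed
    qed (use W(2) in blast)
    ultimately show ?thesis unfolding C0_ext_def by blast
  qed
  show ?thesis
    unfolding exterior_space_def
  proof (intro conjI ballI allI impI)
    show "C0_ext X \<epsilon> \<noteq> {}" using ext_nonempty unfolding C0_ext_def by blast
    fix A assume "A \<in> C0_ext X \<epsilon>"
    then obtain E where E: "E \<in> \<epsilon>" "A = ?W E" unfolding C0_ext_def by blast
    then show "openin (C0 X \<epsilon>) A" using op by simp
    show "U \<in> C0_ext X \<epsilon>" if "openin (C0 X \<epsilon>) U \<and> A \<subseteq> U" for U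
      using up[OF E(1)] that E(2) by simp
    fix B assume "B \<in> C0_ext X \<epsilon>"
    then obtain F where F: "F \<in> \<epsilon>" "B = ?W F" unfolding C0_ext_def by blast
    have "E \<inter> F \<in> \<epsilon>" using E(1) F(1) by (rule ext_Int)
    then show "A \<inter> B \<in> C0_ext X \<epsilon>" unfolding E(2) F(2) int[OF E(1) F(1)] C0_ext_def by blast
  qed
qed

end

end

theory Submission
  imports Defs
begin

text \<open>As a set, the completion is the push-out of the inclusion of the limit space \<open>L(X)\<close> into
  \<open>X\<close> and the map \<open>e\<^sub>0\<close> from \<open>L(X)\<close> to the end space, so \<^const>\<open>p0\<close> is a
  bijection exactly when \<^const>\<open>e0\<close> is one. As \<^const>\<open>p0\<close> is always an exterior map,
  and a bijective \<^const>\<open>p0\<close> carries every exterior open set \<open>E\<close> onto its counterpart in the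
  completion, completeness amounts to: \<^const>\<open>e0\<close> is bijective and \<^const>\<open>p0\<close> is an open map
  (\<open>C0_complete_iff\<close>).

  The three conditions translate these requirements. Condition (ii) is injectivity of \<^const>\<open>e0\<close>,
  because distinct path-components of \<open>E\<close> are disjoint. Condition (i) is openness of \<^const>\<open>p0\<close>,
  once \<^const>\<open>e0\<close> is bijective: at a point \<open>x\<close> of the limit space the topology of the completion asks
  for some \<open>E\<close> and an open set of path-components of \<open>E\<close>, containing that of \<open>x\<close>, whose union lies
  in the given open set; by local path-connectedness the component of \<open>x\<close> alone forms an open set.
  Condition (iii) corresponds to surjectivity of \<^const>\<open>e0\<close>. A \<open>\<pi>\<^sub>0\<close>-net selects one
  path-component of each \<open>E\<close>, that is, a point \<open>a\<close> of the end space; if \<open>a\<close> is \<open>e\<^sub>0 x\<close>,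
  then (i) makes the net converge to \<open>x\<close>. Conversely, picking a point in every component \<open>a E\<close> gives
  a \<open>\<pi>\<^sub>0\<close>-net over the exterior open sets ordered by reverse inclusion; if it converges to \<open>x\<close> in
  the limit space, then it enters the open component of \<open>x\<close> in each \<open>E\<close>, so \<open>e\<^sub>0 x\<close> is \<open>a\<close>.\<close>

section \<open>Path-components and points of the end space\<close>

lemma path_components_of_eq:
  assumes "C \<in> path_components_of Y" "x \<in> C"
  shows "C = path_component_of_set Y x"
proof -
  obtain z where z: "C = path_component_of_set Y z"
    using assms(1) by (auto simp: path_components_of_def)
  then have "path_component_of Y z x" using assms(2) by blast
  then show ?thesis unfolding z by (simp only: path_component_of_equiv)
qed

lemma path_components_of_intersecting_eq:
  assumes "C \<in> path_components_of Y" "D \<in> path_components_of Y" "x \<in> C" "x \<in> D"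
  shows "C = D"
  using path_components_of_eq assms by metis

lemma topspace_exterior:
  assumes "exterior_space X \<epsilon>"
  shows "topspace X \<in> \<epsilon>"
  using ext_nonempty[OF assms] ext_subset[OF assms] ext_up[OF assms] by blast

lemma limit_in_component:
  assumes "exterior_space X \<epsilon>" "x \<in> \<Inter>\<epsilon>" "E \<in> \<epsilon>"
  shows "x \<in> path_component_of_set (subtopology X E) x"
  using assms ext_subset[OF assms(1,3)] by (auto simp: path_component_of_refl)

lemma e0_eval: "E \<in> \<epsilon> \<Longrightarrow> e0 X \<epsilon> x E = path_component_of_set (subtopology X E) x"
  by (simp add: e0_def)

lemma end_space_eqI:
  assumes "a \<in> topspace (end_space X \<epsilon>)" "b \<in> topspace (end_space X \<epsilon>)"
    and "\<And>E. E \<in> \<epsilon> \<Longrightarrow> a E = b E"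
  shows "a = b"
proof (rule PiE_ext)
  show "a \<in> (\<Pi>\<^sub>E E\<in>\<epsilon>. path_components_of (subtopology X E))"
    "b \<in> (\<Pi>\<^sub>E E\<in>\<epsilon>. path_components_of (subtopology X E))"
    using assms(1,2) by (auto simp: end_space_def)
qed (fact assms(3))

lemma end_space_decreasing:
  assumes "exterior_space X \<epsilon>" "a \<in> topspace (end_space X \<epsilon>)" "E \<in> \<epsilon>" "F \<in> \<epsilon>" "E \<subseteq> F"
  shows "a E \<subseteq> a F"
proof
  fix x assume x: "x \<in> a E"
  then have "x \<in> topspace (subtopology X F)"
    using path_components_of_subset[OF end_space_mem[OF assms(1,2,3)]] assms(5) by auto
  then show "x \<in> a F"
    using end_space_mono[OF assms x] by (simp add: path_component_of_refl)
qed

lemma end_space_nonempty: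
  assumes "exterior_space X \<epsilon>" "a \<in> topspace (end_space X \<epsilon>)" "E \<in> \<epsilon>"
  shows "a E \<noteq> {}"
  using nonempty_path_components_of[OF end_space_mem[OF assms]] .

text \<open>A choice of components \<open>a E\<close> is a point of the inverse limit as soon as the chosen components
  of nested sets intersect, because a bonding map sends \<open>a E\<close> to the one component containing it.\<close>

lemma restrict_in_end_space:
  assumes comp: "\<And>E. E \<in> \<epsilon> \<Longrightarrow> a E \<in> path_components_of (subtopology X E)"
    and meet: "\<And>E F. E \<in> \<epsilon> \<Longrightarrow> F \<in> \<epsilon> \<Longrightarrow> E \<subseteq> F \<Longrightarrow> a E \<inter> a F \<noteq> {}"
  shows "restrict a \<epsilon> \<in> topspace (end_space X \<epsilon>)"
proof -
  have "pi0_bond X F (a E) = a F" if EF: "E \<in> \<epsilon>" "F \<in> \<epsilon>" "E \<subseteq> F" for E F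
  proof -
    obtain x where "x \<in> a E" "x \<in> a F" using meet[OF EF] by blast
    then show ?thesis
      using pi0_bond_eq[OF EF(3) comp[OF EF(1)]] path_components_of_eq[OF comp[OF EF(2)]] by metis
  qed
  then show ?thesis using comp by (auto simp: end_space_def PiE_iff)
qed

text \<open>Distinct points of the end space differ at some \<open>E\<close>, and distinct path-components are
  disjoint.\<close>

lemma inj_on_e0_iff_components_separate:
  assumes ext: "exterior_space X \<epsilon>"
  shows "inj_on (e0 X \<epsilon>) (\<Inter>\<epsilon>) \<longleftrightarrow>
    (\<forall>x\<in>\<Inter>\<epsilon>. \<forall>y\<in>\<Inter>\<epsilon>. x \<noteq> y \<longrightarrow> (\<exists>E\<in>\<epsilon>. path_component_of_set (subtopology X E) x \<inter>
       path_component_of_set (subtopology X E) y = {}))"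
proof -
  have "e0 X \<epsilon> x \<noteq> e0 X \<epsilon> y \<longleftrightarrow> (\<exists>E\<in>\<epsilon>. path_component_of_set (subtopology X E) x \<inter>
       path_component_of_set (subtopology X E) y = {})"
    if xy: "x \<in> \<Inter>\<epsilon>" "y \<in> \<Inter>\<epsilon>" for x y
  proof -
    note pts = e0_in_end_space[OF ext xy(1)] e0_in_end_space[OF ext xy(2)]
    have "e0 X \<epsilon> x \<noteq> e0 X \<epsilon> y \<longleftrightarrow> (\<exists>E\<in>\<epsilon>. e0 X \<epsilon> x E \<noteq> e0 X \<epsilon> y E)"
      using end_space_eqI[OF pts] by metis
    also have "\<dots> \<longleftrightarrow> (\<exists>E\<in>\<epsilon>. e0 X \<epsilon> x E \<inter> e0 X \<epsilon> y E = {})"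
    proof (rule bex_cong[OF refl])
      fix E assume E: "E \<in> \<epsilon>"
      note comps = end_space_mem[OF ext pts(1) E] end_space_mem[OF ext pts(2) E]
      show "e0 X \<epsilon> x E \<noteq> e0 X \<epsilon> y E \<longleftrightarrow> e0 X \<epsilon> x E \<inter> e0 X \<epsilon> y E = {}"
        using path_components_of_intersecting_eq[OF comps] nonempty_path_components_of[OF comps(1)]
        by blast
    qed
    finally show ?thesis by (simp add: e0_eval)
  qed
  then show ?thesis unfolding inj_on_def by meson
qed

section \<open>The push-out\<close>

text \<open>The classes of the gluing relation are the fibres of this normal form, which moves every
  point of the limit space to the end space.\<close>

definition glue_normal ::
  "'a topology \<Rightarrow> 'a set set \<Rightarrow> 'a + ('a set \<Rightarrow> 'a set) \<Rightarrow> 'a + ('a set \<Rightarrow> 'a set)" where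
  "glue_normal X \<epsilon> = case_sum (\<lambda>x. if x \<in> \<Inter>\<epsilon> then Inr (e0 X \<epsilon> x) else Inl x) Inr"

lemma glue_rel_iff_normal:
  fixes X :: "'a topology"
  assumes ext: "exterior_space X \<epsilon>"
  shows "(z, w) \<in> glue_rel X \<epsilon> \<longleftrightarrow> glue_normal X \<epsilon> z = glue_normal X \<epsilon> w"
proof -
  define R :: "(('a + ('a set \<Rightarrow> 'a set)) \<times> ('a + ('a set \<Rightarrow> 'a set))) set"
    where "R = {(Inl x, Inr (e0 X \<epsilon> x)) | x. x \<in> \<Inter>\<epsilon>}"
  have glue: "glue_rel X \<epsilon> = (R \<union> R\<inverse>)\<^sup>*"
    by (simp add: glue_rel_def R_def topspace_limit_space[OF ext])
  have "glue_normal X \<epsilon> z = glue_normal X \<epsilon> w" if "(z, w) \<in> (R \<union> R\<inverse>)\<^sup>*"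
    using that
  proof induction
    case (step y z)
    then have "glue_normal X \<epsilon> y = glue_normal X \<epsilon> z" by (auto simp: R_def glue_normal_def)
    then show ?case using step.IH by simp
  qed simp
  moreover have "(z, w) \<in> (R \<union> R\<inverse>)\<^sup>*" if eq: "glue_normal X \<epsilon> z = glue_normal X \<epsilon> w"
  proof -
    have down: "(v, glue_normal X \<epsilon> v) \<in> R\<^sup>=" for v
      by (cases v) (auto simp: R_def glue_normal_def)
    have "(z, glue_normal X \<epsilon> z) \<in> (R \<union> R\<inverse>)\<^sup>*"
      using down[of z] by (elim UnE) auto
    moreover have "(glue_normal X \<epsilon> w, w) \<in> (R \<union> R\<inverse>)\<^sup>*" using down[of w] by (elim UnE) auto
    ultimately show ?thesis using eq by (metis rtrancl_trans)
  qed
  ultimately show ?thesis unfolding glue by blast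
qed

lemma glue_class_eq_iff:
  assumes "exterior_space X \<epsilon>"
  shows "glue_rel X \<epsilon> `` {z} = glue_rel X \<epsilon> `` {w} \<longleftrightarrow> glue_normal X \<epsilon> z = glue_normal X \<epsilon> w"
  unfolding Image_def set_eq_iff by (auto simp: glue_rel_iff_normal[OF assms])

lemma p0_eq_p0_iff:
  assumes "exterior_space X \<epsilon>"
  shows "p0 X \<epsilon> x = p0 X \<epsilon> y \<longleftrightarrow> x = y \<or> x \<in> \<Inter>\<epsilon> \<and> y \<in> \<Inter>\<epsilon> \<and> e0 X \<epsilon> x = e0 X \<epsilon> y"
  by (simp add: p0_def glue_class_eq_iff[OF assms]) (auto simp: glue_normal_def)

lemma p0_eq_in0_iff:
  assumes "exterior_space X \<epsilon>"
  shows "p0 X \<epsilon> x = in0 X \<epsilon> a \<longleftrightarrow> x \<in> \<Inter>\<epsilon> \<and> a = e0 X \<epsilon> x"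
  by (simp add: p0_def in0_def glue_class_eq_iff[OF assms]) (auto simp: glue_normal_def)

lemma topspace_C0:
  assumes ext: "exterior_space X \<epsilon>"
  shows "topspace (C0 X \<epsilon>) = p0 X \<epsilon> ` topspace X \<union> in0 X \<epsilon> ` topspace (end_space X \<epsilon>)"
proof
  have "C0_open X \<epsilon> (topspace (C0 X \<epsilon>))"
    using openin_C0[OF ext] openin_topspace by blast
  then have "topspace (C0 X \<epsilon>) \<subseteq> C0_set X \<epsilon>" by (simp add: C0_open_def)
  then show "topspace (C0 X \<epsilon>) \<subseteq> p0 X \<epsilon> ` topspace X \<union> in0 X \<epsilon> ` topspace (end_space X \<epsilon>)"
    unfolding C0_set_def p0_def in0_def by (auto elim!: quotientE)
  have "p0 X \<epsilon> ` topspace X \<union> in0 X \<epsilon> ` topspace (end_space X \<epsilon>) \<in> C0_ext X \<epsilon>"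
    using topspace_exterior[OF ext] by (auto simp: C0_ext_def)
  then show "p0 X \<epsilon> ` topspace X \<union> in0 X \<epsilon> ` topspace (end_space X \<epsilon>) \<subseteq> topspace (C0 X \<epsilon>)"
    by (rule ext_subset[OF exterior_space_C0[OF ext]])
qed

lemma p0_in_image_iff:
  assumes "exterior_space X \<epsilon>" "inj_on (e0 X \<epsilon>) (\<Inter>\<epsilon>)"
  shows "p0 X \<epsilon> x \<in> p0 X \<epsilon> ` U \<longleftrightarrow> x \<in> U"
proof
  assume "p0 X \<epsilon> x \<in> p0 X \<epsilon> ` U"
  then obtain u where u: "u \<in> U" "p0 X \<epsilon> x = p0 X \<epsilon> u" by blast
  then have "x = u" using assms(2) unfolding p0_eq_p0_iff[OF assms(1)] inj_on_def by blast
  then show "x \<in> U" using u(1) by simp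
qed (rule imageI)

text \<open>The push-out of a bijection is a bijection, and conversely since the inclusion
  \<open>L(X) \<rightarrow> X\<close> is injective.\<close>

lemma bij_betw_p0_iff:
  assumes ext: "exterior_space X \<epsilon>"
  shows "bij_betw (p0 X \<epsilon>) (topspace X) (topspace (C0 X \<epsilon>)) \<longleftrightarrow>
    bij_betw (e0 X \<epsilon>) (\<Inter>\<epsilon>) (topspace (end_space X \<epsilon>))"
proof -
  have sub: "\<Inter>\<epsilon> \<subseteq> topspace X" using topspace_exterior[OF ext] by blast
  have "inj_on (p0 X \<epsilon>) (topspace X) \<longleftrightarrow> inj_on (e0 X \<epsilon>) (\<Inter>\<epsilon>)"
    using sub unfolding inj_on_def p0_eq_p0_iff[OF ext] by blast
  moreover have "p0 X \<epsilon> ` topspace X = topspace (C0 X \<epsilon>) \<longleftrightarrow>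
      e0 X \<epsilon> ` \<Inter>\<epsilon> = topspace (end_space X \<epsilon>)"
  proof -
    have "p0 X \<epsilon> ` topspace X = topspace (C0 X \<epsilon>) \<longleftrightarrow>
        (\<forall>a\<in>topspace (end_space X \<epsilon>). in0 X \<epsilon> a \<in> p0 X \<epsilon> ` topspace X)"
      unfolding topspace_C0[OF ext] by blast
    also have "\<dots> \<longleftrightarrow> (\<forall>a\<in>topspace (end_space X \<epsilon>). a \<in> e0 X \<epsilon> ` \<Inter>\<epsilon>)"
      using sub p0_eq_in0_iff[OF ext] unfolding image_iff by (metis subsetD)
    also have "\<dots> \<longleftrightarrow> e0 X \<epsilon> ` \<Inter>\<epsilon> = topspace (end_space X \<epsilon>)"
      using e0_in_end_space[OF ext] by blast
    finally show ?thesis .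
  qed
  ultimately show ?thesis by (simp add: bij_betw_def)
qed

lemma exterior_map_p0:
  assumes ext: "exterior_space X \<epsilon>"
  shows "exterior_map X \<epsilon> (C0 X \<epsilon>) (C0_ext X \<epsilon>) (p0 X \<epsilon>)"
  unfolding exterior_map_def
proof (intro conjI ballI)
  have "openin X {x \<in> topspace X. p0 X \<epsilon> x \<in> W}" if "openin (C0 X \<epsilon>) W" for W
    using that unfolding openin_C0[OF ext] C0_open_def Let_def by blast
  then show "continuous_map X (C0 X \<epsilon>) (p0 X \<epsilon>)"
    unfolding continuous_map_def topspace_C0[OF ext] by blast
  fix A assume "A \<in> C0_ext X \<epsilon>"
  then show "{x \<in> topspace X. p0 X \<epsilon> x \<in> A} \<in> \<epsilon>"
    using p0_preimage_W0[OF ext] by (auto simp: C0_ext_def)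
qed

text \<open>The inverse of a bijective open \<^const>\<open>p0\<close> is automatically exterior: when every end is the
  image of a point of the limit space, the exterior open set belonging to \<open>E\<close> in the completion is
  just \<open>p\<^sub>0(E)\<close>, since \<open>E\<close> contains the limit space.\<close>

lemma C0_complete_iff:
  assumes ext: "exterior_space X \<epsilon>"
  shows "C0_complete X \<epsilon> \<longleftrightarrow>
    bij_betw (e0 X \<epsilon>) (\<Inter>\<epsilon>) (topspace (end_space X \<epsilon>)) \<and> open_map X (C0 X \<epsilon>) (p0 X \<epsilon>)"
proof
  assume "C0_complete X \<epsilon>"
  then obtain g where g: "exterior_map (C0 X \<epsilon>) (C0_ext X \<epsilon>) X \<epsilon> g"
      "\<forall>x\<in>topspace X. g (p0 X \<epsilon> x) = x" "\<forall>y\<in>topspace (C0 X \<epsilon>). p0 X \<epsilon> (g y) = y"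
    unfolding C0_complete_def exterior_iso_def by (elim conjE exE)
  then have "homeomorphic_maps X (C0 X \<epsilon>) (p0 X \<epsilon>) g"
    using exterior_map_p0[OF ext] unfolding homeomorphic_maps_def exterior_map_def by blast
  then have "homeomorphic_map X (C0 X \<epsilon>) (p0 X \<epsilon>)"
    using homeomorphic_map_maps by blast
  then show "bij_betw (e0 X \<epsilon>) (\<Inter>\<epsilon>) (topspace (end_space X \<epsilon>)) \<and> open_map X (C0 X \<epsilon>) (p0 X \<epsilon>)"
    using bij_betw_p0_iff[OF ext] by (simp add: homeomorphic_eq_everything_map bij_betw_def)
next
  assume R: "bij_betw (e0 X \<epsilon>) (\<Inter>\<epsilon>) (topspace (end_space X \<epsilon>)) \<and> open_map X (C0 X \<epsilon>) (p0 X \<epsilon>)"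
  then have bij: "bij_betw (p0 X \<epsilon>) (topspace X) (topspace (C0 X \<epsilon>))"
    by (simp only: bij_betw_p0_iff[OF ext])
  have "homeomorphic_map X (C0 X \<epsilon>) (p0 X \<epsilon>)"
  proof (rule bijective_open_imp_homeomorphic_map)
    show "continuous_map X (C0 X \<epsilon>) (p0 X \<epsilon>)"
      using exterior_map_p0[OF ext] by (simp add: exterior_map_def)
    show "open_map X (C0 X \<epsilon>) (p0 X \<epsilon>)" using R by blast
    show "p0 X \<epsilon> ` topspace X = topspace (C0 X \<epsilon>)" using bij by (rule bij_betw_imp_surj_on)
    show "inj_on (p0 X \<epsilon>) (topspace X)" using bij by (rule bij_betw_imp_inj_on)
  qed
  then obtain g where "homeomorphic_maps X (C0 X \<epsilon>) (p0 X \<epsilon>) g"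
    using homeomorphic_map_maps by blast
  then have g: "continuous_map (C0 X \<epsilon>) X g"
      "\<forall>x\<in>topspace X. g (p0 X \<epsilon> x) = x" "\<forall>y\<in>topspace (C0 X \<epsilon>). p0 X \<epsilon> (g y) = y"
    by (simp_all add: homeomorphic_maps_def)
  have "{y \<in> topspace (C0 X \<epsilon>). g y \<in> E} \<in> C0_ext X \<epsilon>" if E: "E \<in> \<epsilon>" for E
  proof -
    have sub: "E \<subseteq> topspace X" using ext_subset[OF ext E] .
    have "in0 X \<epsilon> ` topspace (end_space X \<epsilon>) \<subseteq> p0 X \<epsilon> ` E"
    proof (rule image_subsetI)
      fix a assume "a \<in> topspace (end_space X \<epsilon>)"
      then have "a \<in> e0 X \<epsilon> ` \<Inter>\<epsilon>" using R by (simp add: bij_betw_def)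
      then obtain x where x: "x \<in> \<Inter>\<epsilon>" "a = e0 X \<epsilon> x" by blast
      then have "p0 X \<epsilon> x = in0 X \<epsilon> a" using p0_eq_in0_iff[OF ext] by simp
      then show "in0 X \<epsilon> a \<in> p0 X \<epsilon> ` E" using x(1) E by (metis InterD imageI)
    qed
    moreover have "{y \<in> topspace (C0 X \<epsilon>). g y \<in> E} = p0 X \<epsilon> ` E"
    proof (intro set_eqI iffI)
      fix y assume "y \<in> {y \<in> topspace (C0 X \<epsilon>). g y \<in> E}"
      then show "y \<in> p0 X \<epsilon> ` E" using g(3) by (metis (lifting) imageI mem_Collect_eq)
    next
      fix y assume "y \<in> p0 X \<epsilon> ` E"
      then show "y \<in> {y \<in> topspace (C0 X \<epsilon>). g y \<in> E}"
        using g(2) sub topspace_C0[OF ext] by auto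
    qed
    ultimately have "{y \<in> topspace (C0 X \<epsilon>). g y \<in> E} =
        p0 X \<epsilon> ` E \<union> in0 X \<epsilon> ` topspace (end_space X \<epsilon>)" by blast
    then show ?thesis using E by (auto simp: C0_ext_def)
  qed
  then have "exterior_map (C0 X \<epsilon>) (C0_ext X \<epsilon>) X \<epsilon> g"
    using g(1) by (simp add: exterior_map_def)
  then show "C0_complete X \<epsilon>"
    using g(2,3) exterior_map_p0[OF ext] unfolding C0_complete_def exterior_iso_def by blast
qed

section \<open>Small components and open images\<close>

text \<open>The open neighbourhoods of \<open>p\<^sub>0 x = in\<^sub>0 (e\<^sub>0 x)\<close> in the completion contain whole
  path-components of some \<open>E\<close>; injectivity of \<^const>\<open>p0\<close> brings them back into \<open>U\<close>.\<close>

lemma component_subset_if_p0_open: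
  assumes ext: "exterior_space X \<epsilon>" and inj: "inj_on (e0 X \<epsilon>) (\<Inter>\<epsilon>)"
    and op: "openin (C0 X \<epsilon>) (p0 X \<epsilon> ` U)" and U: "x \<in> U" and x: "x \<in> \<Inter>\<epsilon>"
  shows "\<exists>E\<in>\<epsilon>. path_component_of_set (subtopology X E) x \<subseteq> U"
proof -
  have "in0 X \<epsilon> (e0 X \<epsilon> x) \<in> p0 X \<epsilon> ` U"
    using p0_eq_in0_iff[OF ext, of x "e0 X \<epsilon> x"] x U by (metis imageI)
  then have I: "e0 X \<epsilon> x \<in> {a \<in> topspace (end_space X \<epsilon>). in0 X \<epsilon> a \<in> p0 X \<epsilon> ` U}"
    using e0_in_end_space[OF ext x] by simp
  \<comment> \<open>the last clause in the definition of the open sets, at the end of \<open>x\<close>\<close>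
  obtain E G where EG: "E \<in> \<epsilon>" "e0 X \<epsilon> x \<in> {b \<in> topspace (end_space X \<epsilon>). b E \<in> G}"
      "{y \<in> topspace (subtopology X E). path_component_of_set (subtopology X E) y \<in> G}
         \<subseteq> {y \<in> topspace X. p0 X \<epsilon> y \<in> p0 X \<epsilon> ` U}"
    using bspec[OF conjunct2[OF conjunct2[OF conjunct2[OF
          op[unfolded openin_C0[OF ext] C0_open_def Let_def]]]] I]
    by (elim bexE exE conjE)
  have "path_component_of_set (subtopology X E) x \<subseteq> U"
  proof
    fix y assume y: "y \<in> path_component_of_set (subtopology X E) x"
    then have "path_component_of_set (subtopology X E) y = e0 X \<epsilon> x E"
      "y \<in> topspace (subtopology X E)"
      by (simp_all add: path_component_of_equiv e0_eval[OF EG(1)])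
    then have "p0 X \<epsilon> y \<in> p0 X \<epsilon> ` U" using EG by auto
    then show "y \<in> U" using p0_in_image_iff[OF ext inj] by simp
  qed
  then show ?thesis using EG(1) by blast
qed

lemma openin_pi0_singleton_component:
  assumes "locally_path_connected_space Y" "C \<in> path_components_of Y"
  shows "openin (pi0 Y) {C}"
proof -
  have "{y \<in> topspace Y. path_component_of_set Y y = C} = C"
    using path_components_of_eq[OF assms(2)] path_components_of_subset[OF assms(2)]
      path_component_of_refl[of Y] by blast
  then show ?thesis
    using assms openin_path_components_of_locally_path_connected_space by (simp add: openin_pi0)
qed

lemma openin_end_space_evaluation:
  assumes "E \<in> \<epsilon>" "openin (pi0 (subtopology X E)) G"
  shows "openin (end_space X \<epsilon>) {b \<in> topspace (end_space X \<epsilon>). b E \<in> G}"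
proof (rule openin_continuous_map_preimage[OF _ assms(2)])
  show "continuous_map (end_space X \<epsilon>) (pi0 (subtopology X E)) (\<lambda>b. b E)"
    unfolding end_space_def
    by (intro continuous_map_from_subtopology continuous_map_product_projection assms(1))
qed

text \<open>At \<open>e\<^sub>0 x\<close> with \<open>x \<in> U\<close> the required open set \<open>G\<close> of path-components consists of one
  component, that of \<open>x\<close> in an \<open>E\<close> for which it lies in \<open>U\<close>. The ends through this component
  come from points of \<open>U\<close>, because \<open>y\<close> belongs to every component of \<open>e\<^sub>0 y\<close>.\<close>

lemma open_map_p0:
  assumes ext: "exterior_space X \<epsilon>" and lpc: "locally_path_connected_space X"
    and bij: "bij_betw (e0 X \<epsilon>) (\<Inter>\<epsilon>) (topspace (end_space X \<epsilon>))"
    and small: "\<And>x U. x \<in> \<Inter>\<epsilon> \<Longrightarrow> openin X U \<Longrightarrow> x \<in> U \<Longrightarrow>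
      \<exists>E\<in>\<epsilon>. path_component_of_set (subtopology X E) x \<subseteq> U"
  shows "open_map X (C0 X \<epsilon>) (p0 X \<epsilon>)"
  unfolding open_map_def
proof (intro allI impI)
  fix U assume U: "openin X U"
  have inj: "inj_on (e0 X \<epsilon>) (\<Inter>\<epsilon>)" and surj: "e0 X \<epsilon> ` \<Inter>\<epsilon> = topspace (end_space X \<epsilon>)"
    using bij by (simp_all add: bij_betw_def)
  let ?I = "{a \<in> topspace (end_space X \<epsilon>). in0 X \<epsilon> a \<in> p0 X \<epsilon> ` U}"
  have P: "{x \<in> topspace X. p0 X \<epsilon> x \<in> p0 X \<epsilon> ` U} = U"
    using p0_in_image_iff[OF ext inj] openin_subset[OF U] by auto
  have I: "in0 X \<epsilon> a \<in> p0 X \<epsilon> ` U \<longleftrightarrow> (\<exists>x\<in>U \<inter> \<Inter>\<epsilon>. a = e0 X \<epsilon> x)" for a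
  proof -
    have "in0 X \<epsilon> a \<in> p0 X \<epsilon> ` U \<longleftrightarrow> (\<exists>x\<in>U. p0 X \<epsilon> x = in0 X \<epsilon> a)" by auto
    then show ?thesis unfolding p0_eq_in0_iff[OF ext] by blast
  qed
  have nbhd: "\<exists>E\<in>\<epsilon>. \<exists>G. openin (pi0 (subtopology X E)) G \<and>
      a \<in> {b \<in> topspace (end_space X \<epsilon>). b E \<in> G} \<and>
      {b \<in> topspace (end_space X \<epsilon>). b E \<in> G} \<subseteq> ?I \<and>
      {x \<in> topspace (subtopology X E). path_component_of_set (subtopology X E) x \<in> G} \<subseteq> U"
    if a: "a \<in> ?I" for a
  proof -
    obtain x where x: "x \<in> U" "x \<in> \<Inter>\<epsilon>" "a = e0 X \<epsilon> x" using a I by blast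
    then obtain E where E: "E \<in> \<epsilon>" "path_component_of_set (subtopology X E) x \<subseteq> U"
      using small U by blast
    then have aE: "a E \<subseteq> U" using x(3) by (simp add: e0_eval)
    have "locally_path_connected_space (subtopology X E)"
      using lpc ext_open[OF ext E(1)] by (rule locally_path_connected_space_open_subset)
    then have "openin (pi0 (subtopology X E)) {a E}"
      using a end_space_mem[OF ext _ E(1)] by (intro openin_pi0_singleton_component) auto
    moreover have "b \<in> ?I" if b: "b \<in> topspace (end_space X \<epsilon>)" "b E = a E" for b
    proof -
      obtain y where y: "y \<in> \<Inter>\<epsilon>" "b = e0 X \<epsilon> y" using b(1) surj by blast
      then have "y \<in> b E" using limit_in_component[OF ext y(1) E(1)] e0_eval[OF E(1)] by metis
      then have "y \<in> U" using b(2) aE by blast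
      then show ?thesis using y b(1) I by blast
    qed
    moreover have "{y \<in> topspace (subtopology X E).
        path_component_of_set (subtopology X E) y \<in> {a E}} \<subseteq> U"
      using aE path_component_of_refl[of "subtopology X E"] by blast
    ultimately show ?thesis using E(1) a by (intro bexI[of _ E] exI[of _ "{a E}"]) auto
  qed
  have "openin (end_space X \<epsilon>) ?I"
  proof (subst openin_subopen, intro ballI)
    fix a assume "a \<in> ?I"
    from nbhd[OF this] obtain E G where EG: "E \<in> \<epsilon>" "openin (pi0 (subtopology X E)) G"
        "a \<in> {b \<in> topspace (end_space X \<epsilon>). b E \<in> G}"
        "{b \<in> topspace (end_space X \<epsilon>). b E \<in> G} \<subseteq> ?I"
      by (elim bexE exE conjE)
    show "\<exists>T. openin (end_space X \<epsilon>) T \<and> a \<in> T \<and> T \<subseteq> ?I"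
      using openin_end_space_evaluation[OF EG(1,2)] EG(3,4) by (intro exI conjI)
  qed
  moreover have "p0 X \<epsilon> ` U \<subseteq> C0_set X \<epsilon>"
    using openin_subset[OF U] unfolding C0_set_def p0_def by (auto intro!: quotientI)
  ultimately show "openin (C0 X \<epsilon>) (p0 X \<epsilon> ` U)"
    unfolding openin_C0[OF ext] C0_open_def Let_def P using U nbhd by blast
qed

section \<open>Nets and ends\<close>

lemma directed_set_upper_bound:
  assumes "directed_set D le" "a \<in> D" "b \<in> D"
  obtains c where "c \<in> D" "le a c" "le b c"
  using assms unfolding directed_set_def by meson

lemma tails_neq_bot:
  assumes dir: "directed_set D le"
  shows "tails D le \<noteq> bot"
proof -
  have "\<exists>d\<in>D. le d0 d" if "d0 \<in> D" for d0
    using directed_set_upper_bound[OF dir that that] by metis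
  then show ?thesis
    unfolding trivial_limit_def eventually_tails[OF dir] by blast
qed

text \<open>Two tails of a net over a directed set intersect, so the components in which a
  \<open>\<pi>\<^sub>0\<close>-net finally lies are compatible.\<close>

lemma pi0_net_determines_end:
  assumes net: "pi0_net X \<epsilon> D le \<xi>"
  obtains a where "a \<in> topspace (end_space X \<epsilon>)"
    and "\<And>E. E \<in> \<epsilon> \<Longrightarrow> eventually (\<lambda>d. \<xi> d \<in> a E) (tails D le)"
proof -
  have dir: "directed_set D le" using net by (simp add: pi0_net_def)
  have "\<forall>E\<in>\<epsilon>. \<exists>C\<in>path_components_of (subtopology X E). eventually (\<lambda>d. \<xi> d \<in> C) (tails D le)"
    using net unfolding pi0_net_def eventually_tails[OF dir] by blast
  then obtain c where c: "\<And>E. E \<in> \<epsilon> \<Longrightarrow> c E \<in> path_components_of (subtopology X E)"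
      "\<And>E. E \<in> \<epsilon> \<Longrightarrow> eventually (\<lambda>d. \<xi> d \<in> c E) (tails D le)"
    by metis
  have "c E \<inter> c F \<noteq> {}" if "E \<in> \<epsilon>" "F \<in> \<epsilon>" for E F
  proof -
    have "eventually (\<lambda>d. \<xi> d \<in> c E \<and> \<xi> d \<in> c F) (tails D le)"
      using c(2)[OF that(1)] c(2)[OF that(2)] by (rule eventually_conj)
    then obtain d where "\<xi> d \<in> c E \<and> \<xi> d \<in> c F"
      using eventually_happens'[OF tails_neq_bot[OF dir]] by blast
    then show ?thesis by blast
  qed
  then have "restrict c \<epsilon> \<in> topspace (end_space X \<epsilon>)"
    using c(1) by (intro restrict_in_end_space)
  then show thesis using c(2) by (intro that[of "restrict c \<epsilon>"]) auto
qed

text \<open>The hypothesis on nets is applied to a choice of points \<open>s E \<in> a E\<close>, indexed by the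
  exterior open sets under reverse inclusion. If this net converges to \<open>x\<close>, it eventually lies in
  \<open>a E\<close> and in the component of \<open>x\<close> in \<open>E\<close>, which is an open neighbourhood of \<open>x\<close>
  by local path-connectedness; hence the two components coincide.\<close>

lemma end_is_e0_of_net_limit:
  fixes X :: "'a topology"
  assumes ext: "exterior_space X \<epsilon>" and lpc: "locally_path_connected_space X"
    and conv: "\<And>(D :: ('i + 'a set) set) le \<xi>. pi0_net X \<epsilon> D le \<xi> \<Longrightarrow>
      \<exists>x\<in>\<Inter>\<epsilon>. limitin X \<xi> x (tails D le)"
    and a: "a \<in> topspace (end_space X \<epsilon>)"
  shows "a \<in> e0 X \<epsilon> ` \<Inter>\<epsilon>"
proof -
  obtain s where s: "\<And>E. E \<in> \<epsilon> \<Longrightarrow> s E \<in> a E"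
    using bchoice[of \<epsilon> "\<lambda>E x. x \<in> a E"] end_space_nonempty[OF ext a] by (metis ex_in_conv)
  define D :: "('i + 'a set) set" where "D = Inr ` \<epsilon>"
  define le :: "'i + 'a set \<Rightarrow> 'i + 'a set \<Rightarrow> bool" where "le d d' \<longleftrightarrow> projr d' \<subseteq> projr d" for d d'
  define \<xi> where "\<xi> d = s (projr d)" for d :: "'i + 'a set"
  have dir: "directed_set D le"
    unfolding directed_set_def
  proof (intro conjI ballI impI)
    show "D \<noteq> {}" using ext_nonempty[OF ext] by (simp add: D_def)
    fix d d' assume "d \<in> D" "d' \<in> D"
    then obtain E F where "E \<in> \<epsilon>" "F \<in> \<epsilon>" "d = Inr E" "d' = Inr F" by (auto simp: D_def)
    then show "\<exists>c\<in>D. le d c \<and> le d' c"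
      using ext_Int[OF ext] by (intro bexI[of _ "Inr (E \<inter> F)"]) (auto simp: D_def le_def)
  qed (auto simp: le_def)
  have tail: "\<xi> d \<in> a E" if E: "E \<in> \<epsilon>" and d: "d \<in> D" "le (Inr E) d" for E d
  proof -
    obtain F where F: "F \<in> \<epsilon>" "d = Inr F" using d(1) by (auto simp: D_def)
    then have "F \<subseteq> E" using d(2) by (simp add: le_def)
    then show ?thesis
      using end_space_decreasing[OF ext a F(1) E] s[OF F(1)] F(2) by (auto simp: \<xi>_def)
  qed
  have comp: "a E \<in> path_components_of (subtopology X E)" if "E \<in> \<epsilon>" for E
    using end_space_mem[OF ext a that] .
  have "\<xi> d \<in> topspace X" if d: "d \<in> D" for d
  proof -
    obtain F where F: "F \<in> \<epsilon>" "d = Inr F" using d by (auto simp: D_def)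
    then have "\<xi> d \<in> a F" using s by (simp add: \<xi>_def)
    then show ?thesis using path_components_of_subset[OF comp[OF F(1)]] by auto
  qed
  then have "pi0_net X \<epsilon> D le \<xi>"
    unfolding pi0_net_def
  proof (intro conjI ballI dir)
    fix E assume E: "E \<in> \<epsilon>"
    then have "Inr E \<in> D" by (simp add: D_def)
    then show "\<exists>C\<in>path_components_of (subtopology X E). \<exists>d0\<in>D. \<forall>d\<in>D. le d0 d \<longrightarrow> \<xi> d \<in> C"
      using comp[OF E] tail[OF E] by blast
  qed
  then obtain x where x: "x \<in> \<Inter>\<epsilon>" "limitin X \<xi> x (tails D le)" using conv by blast
  have "a E = e0 X \<epsilon> x E" if E: "E \<in> \<epsilon>" for E
  proof -
    have "locally_path_connected_space (subtopology X E)"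
      using lpc ext_open[OF ext E] by (rule locally_path_connected_space_open_subset)
    then have "openin (subtopology X E) (path_component_of_set (subtopology X E) x)"
      by (rule openin_path_component_of_locally_path_connected_space)
    then have "openin X (path_component_of_set (subtopology X E) x)"
      using ext_open[OF ext E] by (rule openin_trans_full)
    then have "eventually (\<lambda>d. \<xi> d \<in> path_component_of_set (subtopology X E) x) (tails D le)"
      using x(2) limit_in_component[OF ext x(1) E] unfolding limitin_def by blast
    then obtain d where d: "d \<in> D"
      "\<forall>d'\<in>D. le d d' \<longrightarrow> \<xi> d' \<in> path_component_of_set (subtopology X E) x"
      unfolding eventually_tails[OF dir] by blast
    have "Inr E \<in> D" using E by (simp add: D_def)
    then obtain c where c: "c \<in> D" "le d c" "le (Inr E) c"
      using directed_set_upper_bound[OF dir d(1)] by metis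
    have "\<xi> c \<in> a E" "\<xi> c \<in> e0 X \<epsilon> x E"
      using tail[OF E c(1,3)] d(2) c(1,2) by (simp_all add: e0_eval[OF E])
    then show ?thesis
      using path_components_of_intersecting_eq[OF comp[OF E]
          end_space_mem[OF ext e0_in_end_space[OF ext x(1)] E]] by metis
  qed
  then have "a = e0 X \<epsilon> x"
    by (rule end_space_eqI[OF a e0_in_end_space[OF ext x(1)]])
  then show ?thesis using x(1) by blast
qed

section \<open>Characterisation of complete spaces\<close>

theorem theorem3p4:
  fixes X :: "'a topology" and \<epsilon> :: "'a set set"
  assumes "exterior_space X \<epsilon>"
    and "locally_path_connected_space X"
  shows "C0_complete X \<epsilon> \<longleftrightarrow>
    (\<forall>x \<in> topspace (limit_space X \<epsilon>). \<forall>U. openin X U \<and> x \<in> U \<longrightarrow>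
       (\<exists>E\<in>\<epsilon>. path_component_of_set (subtopology X E) x \<subseteq> U)) \<and>
    (\<forall>x \<in> topspace (limit_space X \<epsilon>). \<forall>y \<in> topspace (limit_space X \<epsilon>). x \<noteq> y \<longrightarrow>
       (\<exists>E\<in>\<epsilon>. path_component_of_set (subtopology X E) x \<inter>
               path_component_of_set (subtopology X E) y = {})) \<and>
    (\<forall>(D :: ('i + 'a set) set) le \<xi>. pi0_net X \<epsilon> D le \<xi> \<longrightarrow>
       (\<exists>x \<in> topspace (limit_space X \<epsilon>). limitin X \<xi> x (tails D le)))"
    (is "_ \<longleftrightarrow> ?small \<and> ?separate \<and> ?converge")
proof
  note ext = assms(1)
  note L = topspace_limit_space[OF ext]
  assume "C0_complete X \<epsilon>"
  then have inj: "inj_on (e0 X \<epsilon>) (\<Inter>\<epsilon>)"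
    and surj: "e0 X \<epsilon> ` \<Inter>\<epsilon> = topspace (end_space X \<epsilon>)"
    and op: "open_map X (C0 X \<epsilon>) (p0 X \<epsilon>)"
    using C0_complete_iff[OF ext] by (simp_all add: bij_betw_def)
  have small: ?small
    using component_subset_if_p0_open[OF ext inj] op unfolding L open_map_def by blast
  have "\<exists>x\<in>\<Inter>\<epsilon>. limitin X \<xi> x (tails D le)"
    if net: "pi0_net X \<epsilon> D le \<xi>" for D :: "('i + 'a set) set" and le \<xi>
  proof -
    obtain a where a: "a \<in> topspace (end_space X \<epsilon>)"
        "\<And>E. E \<in> \<epsilon> \<Longrightarrow> eventually (\<lambda>d. \<xi> d \<in> a E) (tails D le)"
      using pi0_net_determines_end[OF net] by blast
    obtain x where x: "x \<in> \<Inter>\<epsilon>" "a = e0 X \<epsilon> x" using a(1) surj by blast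
    have "eventually (\<lambda>d. \<xi> d \<in> U) (tails D le)" if U: "openin X U" "x \<in> U" for U
    proof -
      obtain E where E: "E \<in> \<epsilon>" "path_component_of_set (subtopology X E) x \<subseteq> U"
        using small U x(1) unfolding L by blast
      then have "a E \<subseteq> U" using x(2) by (simp add: e0_eval)
      then have "\<xi> d \<in> a E \<Longrightarrow> \<xi> d \<in> U" for d by blast
      with a(2)[OF E(1)] show ?thesis by (rule eventually_mono)
    qed
    then have "limitin X \<xi> x (tails D le)"
      using x(1) topspace_exterior[OF ext] unfolding limitin_def by blast
    then show ?thesis using x(1) by blast
  qed
  moreover have ?separate
    using inj inj_on_e0_iff_components_separate[OF ext] unfolding L by blast
  ultimately show "?small \<and> ?separate \<and> ?converge" using small unfolding L by blast
next
  note ext = assms(1)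
  note L = topspace_limit_space[OF ext]
  assume R: "?small \<and> ?separate \<and> ?converge"
  have "inj_on (e0 X \<epsilon>) (\<Inter>\<epsilon>)"
    using R inj_on_e0_iff_components_separate[OF ext] unfolding L by blast
  moreover have "topspace (end_space X \<epsilon>) \<subseteq> e0 X \<epsilon> ` \<Inter>\<epsilon>"
  proof
    have conv: "\<exists>x\<in>\<Inter>\<epsilon>. limitin X \<xi> x (tails D le)"
      if "pi0_net X \<epsilon> D le \<xi>" for D :: "('i + 'a set) set" and le \<xi>
      using R that unfolding L by blast
    show "a \<in> e0 X \<epsilon> ` \<Inter>\<epsilon>" if "a \<in> topspace (end_space X \<epsilon>)" for a
      using end_is_e0_of_net_limit[OF ext assms(2) conv that] .
  qed
  ultimately have bij: "bij_betw (e0 X \<epsilon>) (\<Inter>\<epsilon>) (topspace (end_space X \<epsilon>))"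
    using e0_in_end_space[OF ext] unfolding bij_betw_def by blast
  have "open_map X (C0 X \<epsilon>) (p0 X \<epsilon>)"
    using R unfolding L by (intro open_map_p0[OF ext assms(2) bij]) blast
  then show "C0_complete X \<epsilon>" using bij C0_complete_iff[OF ext] by blast
qed

end
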